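(* Let $\sigma_v,\sigma_w,\sigma_a,\sigma_b>0$, $p^{(0)}\ge0$, and let $\chi^{(l)}$ be the mean-field squared gradient norm at layer $l$ of a full residual network (FRN) with nonlinearity $\psi_\alpha$. (1) If $\alpha=1$, then $\chi^{(l-m)}=\chi^{(l)}\left(\frac12\sigma_v^2\sigma_w^2+1\right)^m$ for all layers $l\ge m\ge0$. (2) If $\alpha\in(\frac34,1)$, then for all $l>m\ge0$, $$\chi^{(l-m)}=\Theta(1)\,\chi^{(l)}\,\Big(\frac l{l-m}\Big)^R,\qquad R=\frac{\alpha^2}{(1-\alpha)(2\alpha-1)},$$ where the constants in $\Theta(1)$ do not depend on $l$ or $m$.
   Context: The $\alpha$-ReLU is $\psi_\alpha(x)=x^\alpha$ for $x>0$ and $\psi_\alpha(x)=0$ otherwise; its derivative is taken as $\dot\psi_\alpha(x)=\alpha x^{\alpha-1}$ for $x>0$ and $0$ for $x\le0$. Put $\mathrm V f(q)=\mathbb E[f(z)^2]$, $z\sim\mathcal N(0,q)$. An FRN with nonlinearity $\phi$ has layers $x^{(l)}_i=\sum_jv^{(l)}_{ij}\phi(h^{(l)}_j)+x^{(l-1)}_i+a^{(l)}_i$, $h^{(l)}_i=\sum_jw^{(l)}_{ij}x^{(l-1)}_j+b^{(l)}_i$ with independent Gaussian parameters of mean $0$ and variances $\sigma_v^2/N$, $\sigma_a^2$, $\sigma_w^2/N$, $\sigma_b^2$ respectively for $v,a,w,b$. Its mean-field ($N\to\infty$) length quantities are determined by $p^{(0)}$ and, for $l\ge1$, $q^{(l)}=\sigma_w^2p^{(l-1)}+\sigma_b^2$,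 $p^{(l)}=\sigma_v^2\,\mathrm V\phi(q^{(l)})+\sigma_a^2+p^{(l-1)}$. For a loss $E$, the mean-field gradient quantity $\chi^{(l)}=\langle(\partial E/\partial x_1^{(l)})^2\rangle$ (computed with backward weights independent of the forward ones) is determined by its positive value at the last layer and the backward recurrence $\chi^{(l-1)}=(\sigma_v^2\sigma_w^2\,\mathrm V\dot\phi(q^{(l)})+1)\,\chi^{(l)}$. *)

theory Defs
  imports "HOL-Probability.Probability"
begin

definition alpha_relu :: "real \<Rightarrow> real \<Rightarrow> real" where
  "alpha_relu \<alpha> x = (if x > 0 then x powr \<alpha> else 0)"

(* Set to 0 at the origin, where alpha_relu is not differentiable for \<alpha> \<le> 1. *)
definition alpha_relu_deriv :: "real \<Rightarrow> real \<Rightarrow> real" where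
  "alpha_relu_deriv \<alpha> x = (if x > 0 then \<alpha> * x powr (\<alpha> - 1) else 0)"

(* The parameter q is the variance, whereas normal_density takes the standard deviation. *)
definition centered_gaussian :: "real \<Rightarrow> real measure" where
  "centered_gaussian q =
     (if q > 0 then density lborel (\<lambda>x. ennreal (normal_density 0 (sqrt q) x)) else return borel 0)"

(* By the convention for the Bochner integral this is 0 if f^2 is not integrable; for q > 0 the
   squares of alpha_relu \<alpha> and alpha_relu_deriv \<alpha> are integrable whenever \<alpha> > 1/2. *)
definition gauss_sq_mean :: "(real \<Rightarrow> real) \<Rightarrow> real \<Rightarrow> real" where
  "gauss_sq_mean f q = (\<integral>z. (f z)\<^sup>2 \<partial>centered_gaussian q)"

(* frn_p ... l is the mean-field limit of the mean square of the entries of the layer-l activation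
   x in a full residual network with nonlinearity \<phi>, and frn_q ... l that of the pre-activation h.
   For width N the parameters v, a, w, b are independent centred Gaussians of variance
   \<sigma>v^2/N, \<sigma>a^2, \<sigma>w^2/N, \<sigma>b^2, respectively. *)
primrec frn_p ::
  "(real \<Rightarrow> real) \<Rightarrow> real \<Rightarrow> real \<Rightarrow> real \<Rightarrow> real \<Rightarrow> real \<Rightarrow> nat \<Rightarrow> real" where
  "frn_p \<phi> \<sigma>v \<sigma>a \<sigma>w \<sigma>b p0 0 = p0"
| "frn_p \<phi> \<sigma>v \<sigma>a \<sigma>w \<sigma>b p0 (Suc l) =
     \<sigma>v\<^sup>2 * gauss_sq_mean \<phi> (\<sigma>w\<^sup>2 * frn_p \<phi> \<sigma>v \<sigma>a \<sigma>w \<sigma>b p0 l + \<sigma>b\<^sup>2)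
       + \<sigma>a\<^sup>2 + frn_p \<phi> \<sigma>v \<sigma>a \<sigma>w \<sigma>b p0 l"

(* Only meaningful for l \<ge> 1: the input layer 0 has no pre-activation. *)
definition frn_q ::
  "(real \<Rightarrow> real) \<Rightarrow> real \<Rightarrow> real \<Rightarrow> real \<Rightarrow> real \<Rightarrow> real \<Rightarrow> nat \<Rightarrow> real" where
  "frn_q \<phi> \<sigma>v \<sigma>a \<sigma>w \<sigma>b p0 l = \<sigma>w\<^sup>2 * frn_p \<phi> \<sigma>v \<sigma>a \<sigma>w \<sigma>b p0 (l - 1) + \<sigma>b\<^sup>2"

(* chi 0, ..., chi L are the mean-field squared gradient norms of a network of depth L. The second
   argument \<phi>' is the derivative used in backpropagation, passed separately because \<phi> need
   not be differentiable everywhere. *)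
definition frn_chi ::
  "(real \<Rightarrow> real) \<Rightarrow> (real \<Rightarrow> real) \<Rightarrow> real \<Rightarrow> real \<Rightarrow> real \<Rightarrow> real \<Rightarrow> real \<Rightarrow> nat \<Rightarrow> (nat \<Rightarrow> real) \<Rightarrow> bool" where
  "frn_chi \<phi> \<phi>' \<sigma>v \<sigma>a \<sigma>w \<sigma>b p0 L chi \<longleftrightarrow>
     chi L > 0 \<and>
     (\<forall>l\<in>{1..L}. chi (l - 1) =
        (\<sigma>v\<^sup>2 * \<sigma>w\<^sup>2 * gauss_sq_mean \<phi>' (frn_q \<phi> \<sigma>v \<sigma>a \<sigma>w \<sigma>b p0 l) + 1) * chi l)"

end

theory Submission imports Defs begin

text \<open>
  Gaussian moments give \<open>V \<psi>\<^sub>\<alpha>(q) = c q\<^sup>\<alpha>\<close> and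
  \<open>V \<psi>\<^sub>\<alpha>'(q) = \<alpha>\<^sup>2/(2\<alpha> - 1) c q powr (\<alpha> - 1)\<close> with the same \<open>c\<close>, because
  \<open>\<Gamma>(\<alpha> + 1/2) = (\<alpha> - 1/2) \<Gamma>(\<alpha> - 1/2)\<close>. For \<open>\<alpha> < 1\<close> and \<open>A = \<sigma>v\<^sup>2 \<sigma>w\<^sup>2 c\<close> the
  recurrence is \<open>q\<^bsub>k+1\<^esub> = q\<^bsub>k\<^esub> + A q\<^bsub>k\<^esub>\<^sup>\<alpha> + D\<close>, and \<open>u = q powr (1 - \<alpha>)\<close> has increments
  \<open>(1 - \<alpha>) A + O(1/u)\<close>; hence \<open>u\<^bsub>k\<^esub> = (1 - \<alpha>) A k + O(\<surd>k)\<close>. The factor relating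
  \<open>chi (k - 1)\<close> to \<open>chi k\<close> is thus \<open>1 + R/k + O(k powr (-3/2))\<close>, whose logarithm differs from
  \<open>R ln (k/(k - 1))\<close> by a summable error.
\<close>

section \<open>Gaussian moments\<close>

text \<open>The substitution \<open>x = sqrt (2 * q * t)\<close> turns the Gaussian factor into
  \<open>exp (- t)\<close> and the integrand into a constant multiple of the Gamma integrand with
  parameter \<open>(s + 1) / 2\<close>. The condition \<open>s > -1\<close> makes that parameter
  positive.\<close>

lemma half_gaussian_integral:
  fixes q s :: real
  assumes "q > 0" "s > -1"
  shows "(LINT x:{0<..}|lborel. x powr s * exp (- x\<^sup>2 / (2 * q)))
           = q * (2 * q) powr ((s - 1) / 2) * Gamma ((s + 1) / 2)"
proof -
  define f where "f = (\<lambda>x. x powr s * exp (- x\<^sup>2 / (2 * q)))"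
  define g where "g = (\<lambda>t. sqrt (2 * q * t))"
  define g' where "g' = (\<lambda>t. q / sqrt (2 * q * t))"
  define k where "k = q * (2 * q) powr ((s - 1) / 2)"
  define h where "h = (\<lambda>t::real. t powr ((s + 1) / 2 - 1) / exp t)"
  have fg: "f (g t) * g' t = k * h t" if "t > 0" for t
  proof -
    have "f (g t) * g' t = (2 * q * t) powr (s / 2) * exp (- t) * (q * (2 * q * t) powr (- (1 / 2)))"
      using that assms
      by (simp add: f_def g_def g'_def powr_half_sqrt [symmetric] powr_powr powr_minus field_simps
            powr_numeral [symmetric] del: powr_numeral)
    also have "\<dots> = q * ((2 * q * t) powr (s / 2) * (2 * q * t) powr (- (1 / 2))) * exp (- t)"
      by simp
    also have "(2 * q * t) powr (s / 2) * (2 * q * t) powr (- (1 / 2)) = (2 * q * t) powr ((s - 1) / 2)"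
      by (simp add: powr_add [symmetric] diff_divide_distrib)
    also have "\<dots> = (2 * q) powr ((s - 1) / 2) * t powr ((s + 1) / 2 - 1)"
      using that assms by (simp add: powr_mult field_simps)
    finally show ?thesis
      by (simp add: k_def h_def exp_minus field_simps)
  qed
  have hint: "(h has_integral Gamma ((s + 1) / 2)) {0<..}"
  proof -
    have "(h has_integral Gamma ((s + 1) / 2)) {0..}"
      unfolding h_def using assms by (intro Gamma_integral_real) simp
    hence "((\<lambda>t. if t \<in> {0<..} then h t else 0) has_integral Gamma ((s + 1) / 2)) {0..}"
      by (rule has_integral_eq [rotated]) (auto simp: h_def)
    thus ?thesis
      by (subst (asm) has_integral_restrict) auto
  qed
  \<comment> \<open>Nonnegativity upgrades the gauge integral to a Lebesgue integral; measurability
    of \<open>h\<close> then allows passing from the completed measure to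
    \<open>lborel\<close>.\<close>
  have h_abs: "h absolutely_integrable_on {0<..}"
    using hint by (subst absolutely_integrable_on_iff_nonneg) (auto simp: h_def)
  have [measurable]: "h \<in> borel_measurable borel"
    unfolding h_def by measurable
  have hset: "set_integrable lborel {0<..} h"
    using h_abs unfolding set_integrable_def
    by (subst (asm) integrable_completion) auto
  have hval: "(LINT t:{0<..}|lborel. h t) = Gamma ((s + 1) / 2)"
    using set_borel_integral_eq_integral(2) [OF hset] hint by (simp add: integral_unique)
  have fgset: "set_integrable lborel {0<..} (\<lambda>t. f (g t) * g' t)"
    using set_integrable_mult_right [of k lborel "{0<..}" h] hset fg
    by (subst set_integrable_cong [where f' = "\<lambda>t. k * h t"]) auto
  \<comment> \<open>The nonnegative substitution rule asks for integrability only after the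
    substitution, which \<open>fgset\<close> supplies. The singularity of \<open>g'\<close> at 0 is
    harmless because continuity is required only inside the interval.\<close>
  have "(LBINT x=0..\<infinity>. f x) = (LBINT x=0..\<infinity>. f (g x) * g' x)"
  proof (rule interval_integral_substitution_nonneg(2))
    show "DERIV g x :> g' x" if "0 < ereal x" for x
    proof -
      have "q * x > 0" using that assms by simp
      thus ?thesis
        unfolding g_def g'_def by (auto intro!: derivative_eq_intros simp: field_simps)
    qed
    show "isCont f (g x)" if "0 < ereal x" for x
      using that assms unfolding f_def g_def by (auto intro!: continuous_intros)
    show "isCont g' x" if "0 < ereal x" for x
      using that assms unfolding g'_def by (auto intro!: continuous_intros)
    show "0 \<le> g' x" if "0 \<le> ereal x" for x
      using that assms unfolding g'_def by auto
    have "(g \<longlongrightarrow> 0) (at_right 0)"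
      unfolding g_def by (auto intro!: tendsto_eq_intros)
    thus "((ereal \<circ> g \<circ> real_of_ereal) \<longlongrightarrow> 0) (at_right 0)"
      by (simp add: zero_ereal_def ereal_tendsto_simps)
    have "filterlim g at_top at_top"
      unfolding g_def using assms
      by (intro filterlim_compose [OF sqrt_at_top] filterlim_tendsto_pos_mult_at_top
            [OF tendsto_const _ filterlim_ident]) auto
    thus "((ereal \<circ> g \<circ> real_of_ereal) \<longlongrightarrow> \<infinity>) (at_left \<infinity>)"
      by (simp add: ereal_tendsto_simps)
    show "set_integrable lborel (einterval 0 \<infinity>) (\<lambda>t. f (g t) * g' t)"
      using fgset by (simp add: zero_ereal_def)
  qed (auto simp: f_def)
  hence "(LINT x:{0<..}|lborel. f x) = (LINT t:{0<..}|lborel. f (g t) * g' t)"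
    by (simp add: interval_lebesgue_integral_0_infty)
  also have "\<dots> = (LINT t:{0<..}|lborel. k * h t)"
    by (rule set_lebesgue_integral_cong) (auto simp: fg)
  also have "\<dots> = k * Gamma ((s + 1) / 2)"
    using hval by simp
  finally show ?thesis by (simp add: f_def k_def)
qed

text \<open>Common source of both Gaussian means below: the squared nonlinearity is the case
  \<open>s = 2 * \<alpha>\<close>, the squared derivative the case
  \<open>s = 2 * \<alpha> - 2\<close> up to the factor \<open>\<alpha>\<^sup>2\<close>.\<close>

lemma centered_gaussian_half_moment:
  fixes q s :: real
  assumes "q > 0" "s > -1"
  shows "(\<integral>z. (if z > 0 then z powr s else 0) \<partial>centered_gaussian q)
           = (2 * q) powr (s / 2) * Gamma ((s + 1) / 2) / (2 * sqrt pi)"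
proof -
  have "(\<integral>z. (if z > 0 then z powr s else 0) \<partial>centered_gaussian q)
      = (\<integral>z. normal_density 0 (sqrt q) z * (if z > 0 then z powr s else 0) \<partial>lborel)"
    using assms by (simp add: centered_gaussian_def integral_density)

  also have "\<dots> = (LINT x:{0<..}|lborel. (1 / sqrt (2 * pi * q)) * (x powr s * exp (- x\<^sup>2 / (2 * q))))"
    unfolding set_lebesgue_integral_def using assms
    by (intro Bochner_Integration.integral_cong)
      (auto simp: normal_density_def indicator_def)
  also have "\<dots> = 1 / sqrt (2 * pi * q) * (q * (2 * q) powr ((s - 1) / 2) * Gamma ((s + 1) / 2))"
    using half_gaussian_integral [OF assms] by simp
  also have "(2 * q) powr ((s - 1) / 2) = (2 * q) powr (s / 2) / sqrt (2 * q)"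
    using assms by (simp add: powr_half_sqrt [symmetric] powr_diff [symmetric] diff_divide_distrib)
  also have "1 / sqrt (2 * pi * q) * (q * ((2 * q) powr (s / 2) / sqrt (2 * q)) * Gamma ((s + 1) / 2))
      = (2 * q) powr (s / 2) * Gamma ((s + 1) / 2) / (2 * sqrt pi)"
    using assms by (simp add: real_sqrt_mult field_simps)
  finally show ?thesis .
qed

lemma gauss_sq_mean_alpha_relu:
  assumes "q > 0" "\<alpha> > -1/2"
  shows "gauss_sq_mean (alpha_relu \<alpha>) q
           = 2 powr \<alpha> * Gamma (\<alpha> + 1 / 2) / (2 * sqrt pi) * q powr \<alpha>"
proof -
  have "(alpha_relu \<alpha> z)\<^sup>2 = (if z > 0 then z powr (2 * \<alpha>) else 0)" for z
    by (simp add: alpha_relu_def power2_eq_square powr_add [symmetric])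
  thus ?thesis
    using centered_gaussian_half_moment [of q "2 * \<alpha>"] assms
    by (simp add: gauss_sq_mean_def powr_mult add_divide_distrib)
qed

text \<open>\<open>\<alpha> > 1/2\<close> is what makes \<open>z powr (2 * \<alpha> - 2)\<close>
  integrable at the origin. The prefactor is expressed through the constant of
  \<open>gauss_sq_mean_alpha_relu\<close> so that this constant later cancels from the exponent
  \<open>R\<close>.\<close>

lemma gauss_sq_mean_alpha_relu_deriv:
  assumes "q > 0" "\<alpha> > 1/2"
  shows "gauss_sq_mean (alpha_relu_deriv \<alpha>) q
           = \<alpha>\<^sup>2 / (2 * \<alpha> - 1) * (2 powr \<alpha> * Gamma (\<alpha> + 1 / 2) / (2 * sqrt pi)) * q powr (\<alpha> - 1)"
proof -
  have "(alpha_relu_deriv \<alpha> z)\<^sup>2 = \<alpha>\<^sup>2 * (if z > 0 then z powr (2 * \<alpha> - 2) else 0)" for z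
    by (simp add: alpha_relu_deriv_def power2_eq_square powr_add [symmetric])
  moreover have "(\<integral>z. (if z > 0 then z powr (2 * \<alpha> - 2) else 0) \<partial>centered_gaussian q)
      = (2 * q) powr (\<alpha> - 1) * Gamma (\<alpha> - 1 / 2) / (2 * sqrt pi)"
  proof -
    have "(2 * \<alpha> - 2) / 2 = \<alpha> - 1" "(2 * \<alpha> - 2 + 1) / 2 = \<alpha> - 1 / 2"
      by (simp_all add: field_simps)
    thus ?thesis
      using centered_gaussian_half_moment [of q "2 * \<alpha> - 2"] assms by (simp only:)
  qed
  moreover have "Gamma (\<alpha> + 1 / 2) = (\<alpha> - 1 / 2) * Gamma (\<alpha> - 1 / 2)"
    using Gamma_plus1 [of "\<alpha> - 1 / 2"] assms
    by (simp add: nonpos_Ints_def algebra_simps)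
  ultimately show ?thesis
    using assms powr_diff [of q \<alpha> 1] powr_diff [of 2 \<alpha> 1]
    by (simp add: gauss_sq_mean_def powr_mult) (simp add: divide_simps)
qed

section \<open>Growth of the length recurrence\<close>

text \<open>Weighted AM-GM for the numbers \<open>1 + x\<close> and 1 with weights \<open>b\<close>
  and \<open>1 - b\<close>.\<close>

lemma one_plus_powr_le:
  fixes x b :: real
  assumes "x \<ge> 0" "0 \<le> b" "b \<le> 1"
  shows "(1 + x) powr b \<le> 1 + b * x"
proof -
  have "(1 + x) powr b * 1 powr (1 - b) \<le> b * (1 + x) + (1 - b) * 1"
    using assms by (intro Youngs_inequality_0) auto
  thus ?thesis by (simp add: algebra_simps)
qed

lemma ln_one_plus_ge:
  fixes x :: real
  assumes "x \<ge> 0"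
  shows "x / (1 + x) \<le> ln (1 + x)"
proof -
  have "ln (1 / (1 + x)) \<le> 1 / (1 + x) - 1"
    using assms by (intro ln_le_minus_one) auto
  thus ?thesis using assms by (simp add: ln_div field_simps)
qed

text \<open>Counterpart of \<open>one_plus_powr_le\<close> that agrees with it to first order in
  \<open>x\<close>; the loss from dividing by \<open>1 + x\<close> is quadratic. It combines
  \<open>exp t \<ge> 1 + t\<close> with the lower bound on the logarithm.\<close>

lemma one_plus_powr_ge:
  fixes x b :: real
  assumes "x \<ge> 0" "0 \<le> b"
  shows "1 + b * (x / (1 + x)) \<le> (1 + x) powr b"
proof -
  have "1 + b * (x / (1 + x)) \<le> 1 + b * ln (1 + x)"
    using ln_one_plus_ge [of x] assms by (intro add_left_mono mult_left_mono) auto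
  also have "\<dots> \<le> exp (b * ln (1 + x))"
    by (rule exp_ge_add_one_self)
  also have "\<dots> = (1 + x) powr b"
    using assms by (simp add: powr_def)
  finally show ?thesis .
qed

text \<open>Writing \<open>q' = q * (1 + x)\<close> with \<open>x = A / u + D / q\<close> and
  \<open>u = q powr b\<close> gives \<open>q' powr b = u * (1 + x) powr b\<close>, whose first-order
  increment is \<open>b * A\<close> plus the drift \<open>b * D * (u / q)\<close>. The first
  conclusion yields uniform growth, the second the exact slope.\<close>

lemma power_recurrence_increment:
  fixes q q0 A D a :: real
  assumes a: "1/2 \<le> a" "a < 1" and A: "A > 0" and D: "D \<ge> 0" and q0: "0 < q0" "q0 \<le> q"
  defines "b \<equiv> 1 - a"
  defines "q' \<equiv> q + A * q powr a + D"
  shows "b * A / (1 + A / q0 powr b) \<le> q' powr b - q powr b"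
    and "\<bar>q' powr b - q powr b - b * A\<bar> \<le> (b * A\<^sup>2 + b * D * q0 powr (b - a)) / q powr b"
proof -
  define u where "u = q powr b"
  define x where "x = A / u + D / q"
  have q: "q > 0" and b: "0 < b" "b \<le> a" "b \<le> 1"
    using a q0 by (auto simp: b_def)
  have u: "u > 0" and q0u: "q0 powr b \<le> u"
    using q q0 b by (auto simp: u_def intro: powr_mono2)
  have "0 \<le> D / q" "0 \<le> A / u"
    using q D A u by simp_all
  hence x: "A / u \<le> x" "0 \<le> x"
    unfolding x_def by linarith+
  have "q' = q * (1 + x)"
    using q by (simp add: q'_def x_def u_def b_def powr_diff field_simps)
  hence q': "q' powr b = u * (1 + x) powr b"
    using q x by (simp add: powr_mult u_def)
  have "b * A / (1 + A / u) = u * (b * (A / u / (1 + A / u)))"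
    using u A by (simp add: field_simps)
  also have "\<dots> \<le> u * ((1 + A / u) powr b - 1)"
    using one_plus_powr_ge [of "A / u" b] u A b by (intro mult_left_mono) auto
  \<comment> \<open>For the lower bound the drift \<open>D / q\<close> is discarded by
    monotonicity.\<close>
  also have "\<dots> \<le> u * ((1 + x) powr b - 1)"
    using x u A b by (intro mult_left_mono diff_right_mono powr_mono2) auto
  finally have low: "b * A / (1 + A / u) \<le> q' powr b - u"
    by (simp add: q' algebra_simps)
  have "b * A / (1 + A / q0 powr b) \<le> b * A / (1 + A / u)"
    using u q0u q0 A b by (intro divide_left_mono add_left_mono mult_pos_pos add_pos_pos) auto
  thus "b * A / (1 + A / q0 powr b) \<le> q' powr b - q powr b"
    using low by (simp add: u_def)
  have "b * A - b * A\<^sup>2 / u \<le> b * A / (1 + A / u)"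
    using u A b by (simp add: field_simps power2_eq_square)
  hence lo: "- (b * A\<^sup>2 / u) \<le> q' powr b - u - b * A"
    using low by simp
  have "u * (1 + x) powr b \<le> u * (1 + b * x)"
    using one_plus_powr_le [of x b] x b u by (intro mult_left_mono) auto
  also have "\<dots> = u + b * A + b * D * (u / q)"
    using u by (simp add: x_def field_simps)
  also have "u / q = q powr (b - a) / u"
    using q by (simp add: u_def powr_diff b_def field_simps powr_add [symmetric])
  \<comment> \<open>Since \<open>1/2 \<le> a\<close> gives \<open>b \<le> a\<close>, the exponent is
    nonpositive and the power is largest at \<open>q0\<close>.\<close>
  also have "\<dots> \<le> q0 powr (b - a) / u"
    using u q0 b by (intro divide_right_mono powr_mono2') auto
  finally have "q' powr b - u - b * A \<le> b * D * (q0 powr (b - a) / u)"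
    using D b by (simp add: q' mult_left_mono)
  moreover have "0 \<le> b * D * (q0 powr (b - a) / u)" "0 \<le> b * A\<^sup>2 / u"
    using b D u by auto
  ultimately have "\<bar>q' powr b - u - b * A\<bar> \<le> b * A\<^sup>2 / u + b * D * (q0 powr (b - a) / u)"
    using lo by linarith
  thus "\<bar>q' powr b - q powr b - b * A\<bar> \<le> (b * A\<^sup>2 + b * D * q0 powr (b - a)) / q powr b"
    by (simp add: u_def add_divide_distrib)
qed

text \<open>An increment error of order \<open>1/u\<close> only accumulates logarithmically; the cruder
  bound by a multiple of \<open>\<surd>n\<close> suffices and allows a direct induction.\<close>

lemma asymptotically_linear:
  fixes u :: "nat \<Rightarrow> real"
  assumes u1: "u 1 > 0" and d: "d > 0" and K: "K \<ge> 0"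
    and low: "\<And>n. n \<ge> 1 \<Longrightarrow> d \<le> u (Suc n) - u n"
    and close: "\<And>n. n \<ge> 1 \<Longrightarrow> \<bar>u (Suc n) - u n - g\<bar> \<le> K / u n"
  obtains e C where "e > 0" "C \<ge> 0" "\<And>n. n \<ge> 1 \<Longrightarrow> e * real n \<le> u n"
    "\<And>n. n \<ge> 1 \<Longrightarrow> \<bar>u n - g * real n\<bar> \<le> C * sqrt (real n)"
proof -
  define e where "e = min d (u 1)"
  have e: "e > 0" "e \<le> d" "e \<le> u 1"
    using d u1 by (auto simp: e_def)
  have lin: "e * real n \<le> u n" if "n \<ge> 1" for n
    using that
  proof (induction n rule: dec_induct)
    case (step n)
    thus ?case using low [of n] e by (simp add: algebra_simps)
  qed (use e in auto)
  \<comment> \<open>The first entry starts the induction. The second absorbs the error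
    \<open>K / (e * n)\<close> of one step, because \<open>sqrt (n + 1) - sqrt n\<close> is at least
    \<open>1 / (3 * n)\<close>.\<close>
  define C where "C = max \<bar>u 1 - g\<bar> (3 * K / e)"
  have C: "C \<ge> 0" "3 * K / e \<le> C" "\<bar>u 1 - g\<bar> \<le> C"
    by (auto simp: C_def)
  have "\<bar>u n - g * real n\<bar> \<le> C * sqrt (real n)" if "n \<ge> 1" for n
    using that
  proof (induction n rule: dec_induct)
    case (step n)
    have "K / u n \<le> K / (e * real n)"
      using lin [of n] step e K by (intro divide_left_mono mult_pos_pos) (auto intro: less_le_trans [of 0 "e * real n"])
    also have "\<dots> = 3 * K / e * (1 / (3 * real n))"
      by simp
    also have "\<dots> \<le> C * (1 / (3 * real n))"
      using C by (intro mult_right_mono) auto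
    also have "\<dots> \<le> C * (sqrt (real (Suc n)) - sqrt (real n))"
    proof (intro mult_left_mono)
      \<comment> \<open>The difference \<open>t - s\<close> equals \<open>1 / (s + t)\<close>, and
        \<open>s + t \<le> 3 * s \<le> 3 * n\<close> for \<open>n \<ge> 1\<close>.\<close>
      define s t where "s = sqrt (real n)" and "t = sqrt (real (Suc n))"
      have s: "s \<ge> 1" "s\<^sup>2 = real n" "t\<^sup>2 = real n + 1" "s \<le> t"
        using step by (auto simp: s_def t_def)
      have "t \<le> 2 * s"
      proof (rule power2_le_imp_le)
        show "t\<^sup>2 \<le> (2 * s)\<^sup>2"
          using s step by (simp add: power_mult_distrib)
      qed (use s in auto)
      moreover have "s \<le> s\<^sup>2"
        using s(1) by (simp add: power2_eq_square mult_left_mono)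
      ultimately have "s + t \<le> 3 * real n"
        using s by linarith
      hence "1 / (3 * real n) \<le> 1 / (s + t)"
        using s step by (intro divide_left_mono mult_pos_pos) auto
      also have "1 / (s + t) = t - s"
      proof -
        have "(t - s) * (s + t) = 1"
          using s by (simp add: algebra_simps power2_eq_square)
        thus ?thesis using s by (simp add: field_simps)
      qed
      finally show "1 / (3 * real n) \<le> t - s" .
    qed (use C in auto)
    finally have "\<bar>u (Suc n) - u n - g\<bar> \<le> C * (sqrt (real (Suc n)) - sqrt (real n))"
      using close [of n] step by linarith
    thus ?case
      using step.IH by (simp add: algebra_simps)
  qed (use C in auto)
  with e lin C that show thesis by blast
qed

text \<open>The difference of reciprocals has a numerator of order \<open>sqrt n\<close> over a
  product of two linear quantities. The separate bound \<open>e * n \<le> u n\<close> controls the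
  denominator also for small \<open>n\<close>, where \<open>close\<close> alone need not.\<close>

lemma inverse_asymptotically_linear:
  fixes u :: "nat \<Rightarrow> real"
  assumes e: "e > 0" and g: "g > 0" and n: "n \<ge> 1"
    and lin: "e * real n \<le> u n" and close: "\<bar>u n - g * real n\<bar> \<le> C * sqrt (real n)"
  shows "\<bar>1 / u n - 1 / (g * real n)\<bar> \<le> C / (e * g) * real n powr (-3/2)"
proof -
  have u: "u n > 0"
    using e n lin by (auto intro: less_le_trans [of 0 "e * real n"])
  have sq: "sqrt (real n) / (real n)\<^sup>2 = real n powr (-3/2)"
    using n by (simp add: powr_half_sqrt [symmetric] powr_diff [symmetric] flip: powr_numeral)
  have "\<bar>1 / u n - 1 / (g * real n)\<bar> = \<bar>(g * real n - u n) / (u n * (g * real n))\<bar>"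
    using u g n by (simp add: field_simps)
  also have "\<dots> = \<bar>u n - g * real n\<bar> / (u n * (g * real n))"
    using u g n by (simp add: abs_minus_commute)
  also have "\<dots> \<le> C * sqrt (real n) / (e * real n * (g * real n))"
    using u g n e lin close by (intro frac_le mult_right_mono) auto
  also have "\<dots> = C / (e * g) * (sqrt (real n) / (real n)\<^sup>2)"
    by (simp add: power2_eq_square)
  finally show ?thesis by (simp only: sq)
qed

text \<open>Each \<open>ln (1 + w k)\<close> is compared with \<open>R * ln (k / (k - 1))\<close>,
  whose sum telescopes. Both are \<open>R / k\<close> up to a summable error, so the full error
  series bounds every partial sum, uniformly in \<open>n\<close> and \<open>l\<close>.\<close>

lemma sum_ln_one_plus_asymp:
  fixes w :: "nat \<Rightarrow> real"
  assumes w: "\<And>k. k \<ge> 1 \<Longrightarrow> w k \<ge> 0" and R: "R \<ge> 0" and C: "C \<ge> 0"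
    and close: "\<And>k. k \<ge> 1 \<Longrightarrow> \<bar>w k - R / real k\<bar> \<le> C * real k powr (-3/2)"
  obtains S where
    "\<And>n l. 1 \<le> n \<Longrightarrow> n \<le> l \<Longrightarrow>
       \<bar>(\<Sum>k\<in>{n<..l}. ln (1 + w k)) - R * ln (real l / real n)\<bar> \<le> S"
proof -
  \<comment> \<open>The summands pay, in order, for replacing \<open>ln (1 + w k)\<close> by
    \<open>w k\<close>, then by \<open>R / k\<close>, then by \<open>R\<close> times the logarithmic
    increment.\<close>
  define M where "M = (R + C)\<^sup>2 + C + 2 * R"
  define f where "f = (\<lambda>k. M * real k powr (-3/2))"
  define G where "G = (\<lambda>k. ln (1 + w k) - R * (ln (real k) - ln (real (k - 1))))"
  have M: "M \<ge> 0" using R C by (simp add: M_def)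
  have G: "\<bar>G k\<bar> \<le> f k" if k: "k \<ge> 2" for k
  proof -
    define z where "z = real k powr (-3/2)"
    have w0: "w k \<ge> 0" using w k by simp
    have kz: "1 / (real k)\<^sup>2 \<le> z"
    proof -
      have "1 / (real k)\<^sup>2 = real k powr (-2)"
        using k by (simp add: powr_minus field_simps)
      also have "\<dots> \<le> z" unfolding z_def using k by (intro powr_mono) auto
      finally show ?thesis .
    qed
    have "z \<le> real k powr (-1)" unfolding z_def using k by (intro powr_mono) auto
    hence z1: "z \<le> 1 / real k" using k by (simp add: powr_minus field_simps)
    have cl: "\<bar>w k - R / real k\<bar> \<le> C * z"
      using close [of k] k by (simp add: z_def)
    \<comment> \<open>The cruder \<open>z \<le> 1 / k\<close> shows that \<open>w k\<close> is of
      order \<open>1 / k\<close>, so its square is of order \<open>1 / k\<^sup>2\<close> and hence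
      at most a multiple of \<open>z\<close>.\<close>
    have "C * z \<le> C * (1 / real k)" using z1 C by (intro mult_left_mono)
    hence wk: "w k \<le> (R + C) / real k"
      using cl by (simp add: add_divide_distrib)
    have "w k - (w k)\<^sup>2 \<le> w k / (1 + w k)"
      using w0 by (simp add: field_simps power2_eq_square)
    hence "\<bar>ln (1 + w k) - w k\<bar> \<le> (w k)\<^sup>2"
      using ln_one_plus_ge [OF w0] ln_add_one_self_le_self [OF w0] by linarith
    also have "\<dots> \<le> ((R + C) / real k)\<^sup>2"
      using wk w0 by (intro power_mono)
    also have "\<dots> = (R + C)\<^sup>2 * (1 / (real k)\<^sup>2)"
      by (simp add: power_divide)
    also have "\<dots> \<le> (R + C)\<^sup>2 * z"
      using kz by (intro mult_left_mono) auto
    finally have 1: "\<bar>ln (1 + w k) - w k\<bar> \<le> (R + C)\<^sup>2 * z" .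
    define y where "y = ln (real k) - ln (real (k - 1))"
    have pos: "real k > 0" "real (k - 1) > 0" and km: "real (k - 1) = real k - 1"
      using k by auto
    \<comment> \<open>Applying \<open>ln t \<le> t - 1\<close> to the ratio and to its inverse traps
      \<open>y\<close> between \<open>1 / k\<close> and \<open>1 / (k - 1)\<close>. The gap
      \<open>1 / (k * (k - 1))\<close> is at most \<open>2 / k\<^sup>2\<close> because
      \<open>k \<ge> 2\<close>.\<close>
    have "y = ln (real k / real (k - 1))" "- y = ln (real (k - 1) / real k)"
      using pos by (simp_all add: y_def ln_div)
    moreover have "ln (real k / real (k - 1)) \<le> real k / real (k - 1) - 1"
      "ln (real (k - 1) / real k) \<le> real (k - 1) / real k - 1"
      using pos by (auto intro!: ln_le_minus_one)
    moreover have "real k / real (k - 1) - 1 = 1 / (real k - 1)" "real (k - 1) / real k - 1 = - (1 / real k)"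
      using pos km by (simp_all add: field_simps)
    ultimately have "1 / real k \<le> y" "y \<le> 1 / (real k - 1)" by simp_all
    moreover have "1 / (real k - 1) - 1 / real k \<le> 2 * (1 / (real k)\<^sup>2)"
      using k by (simp add: field_simps power2_eq_square)
    ultimately have "\<bar>1 / real k - y\<bar> \<le> 2 * z"
      using kz by linarith
    hence "R * \<bar>1 / real k - y\<bar> \<le> R * (2 * z)"
      using R by (intro mult_left_mono)
    moreover have "\<bar>R / real k - R * y\<bar> = R * \<bar>1 / real k - y\<bar>"
      using R abs_mult [of R "1 / real k - y"] by (simp add: right_diff_distrib)
    ultimately have 2: "\<bar>R / real k - R * y\<bar> \<le> 2 * R * z"
      by simp
    have "\<bar>ln (1 + w k) - R * y\<bar> \<le> (R + C)\<^sup>2 * z + C * z + 2 * R * z"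
      using 1 2 cl by linarith
    thus ?thesis by (simp add: G_def f_def M_def y_def z_def algebra_simps)
  qed
  have summ: "summable f"
    unfolding f_def by (intro summable_mult) (simp add: summable_real_powr_iff)
  show thesis
  proof (rule that [of "suminf f"])
    fix n l :: nat
    assume nl: "1 \<le> n" "n \<le> l"
    have tele: "(\<Sum>k\<in>{n<..l}. ln (real k) - ln (real (k - 1))) = ln (real l) - ln (real n)"
      using nl(2) by (induction l rule: dec_induct) (auto simp: atLeastSucAtMost_greaterThanAtMost [symmetric])
    have "(\<Sum>k\<in>{n<..l}. ln (1 + w k)) - R * ln (real l / real n) = (\<Sum>k\<in>{n<..l}. G k)"
      unfolding G_def sum_subtractf sum_distrib_left [symmetric] using nl
      by (simp only: sum_subtractf sum_distrib_left [symmetric] tele [unfolded sum_subtractf]) (simp add: ln_div)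
    also have "\<bar>\<dots>\<bar> \<le> (\<Sum>k\<in>{n<..l}. f k)"
      using nl G by (intro order_trans [OF sum_abs] sum_mono) auto
    also have "\<dots> \<le> suminf f"
      using summ M by (intro sum_le_suminf) (auto simp: f_def)
    finally show "\<bar>(\<Sum>k\<in>{n<..l}. ln (1 + w k)) - R * ln (real l / real n)\<bar> \<le> suminf f" .
  qed
qed

section \<open>Mean-field gradients\<close>

lemma gauss_sq_mean_nonneg: "gauss_sq_mean f q \<ge> 0"
  by (simp add: gauss_sq_mean_def)

lemma frn_p_nonneg: "p0 \<ge> 0 \<Longrightarrow> frn_p \<phi> \<sigma>v \<sigma>a \<sigma>w \<sigma>b p0 l \<ge> 0"
  by (induction l) (auto intro!: add_nonneg_nonneg mult_nonneg_nonneg gauss_sq_mean_nonneg)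

text \<open>The bias variance is a positive floor for all lengths when \<sigma>b > 0: it keeps the
  Gaussians nondegenerate and serves as \<open>q0\<close> in the increment estimate.\<close>

lemma frn_q_ge: "p0 \<ge> 0 \<Longrightarrow> \<sigma>b\<^sup>2 \<le> frn_q \<phi> \<sigma>v \<sigma>a \<sigma>w \<sigma>b p0 l"
  by (simp add: frn_q_def frn_p_nonneg)

text \<open>Eliminates \<open>frn_p\<close> in favour of a recurrence in \<open>frn_q\<close> alone.
  It starts at \<open>l = 1\<close>, since truncated subtraction makes \<open>frn_q\<close> take the
  same value at 0 and 1.\<close>

lemma frn_q_Suc:
  assumes "l \<ge> 1"
  shows "frn_q \<phi> \<sigma>v \<sigma>a \<sigma>w \<sigma>b p0 (Suc l) = frn_q \<phi> \<sigma>v \<sigma>a \<sigma>w \<sigma>b p0 l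
    + \<sigma>w\<^sup>2 * \<sigma>v\<^sup>2 * gauss_sq_mean \<phi> (frn_q \<phi> \<sigma>v \<sigma>a \<sigma>w \<sigma>b p0 l) + \<sigma>w\<^sup>2 * \<sigma>a\<^sup>2"
  using assms by (cases l) (simp_all add: frn_q_def algebra_simps)

lemma frn_chi_eq_prod:
  assumes "frn_chi \<phi> \<phi>' \<sigma>v \<sigma>a \<sigma>w \<sigma>b p0 L chi" "n \<le> l" "l \<le> L"
  shows "chi n = chi l *
    (\<Prod>k\<in>{n<..l}. 1 + \<sigma>v\<^sup>2 * \<sigma>w\<^sup>2 * gauss_sq_mean \<phi>' (frn_q \<phi> \<sigma>v \<sigma>a \<sigma>w \<sigma>b p0 k))"
  using assms(2,3)
proof (induction l rule: dec_induct)
  case (step l)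
  have "chi l = (\<sigma>v\<^sup>2 * \<sigma>w\<^sup>2 * gauss_sq_mean \<phi>' (frn_q \<phi> \<sigma>v \<sigma>a \<sigma>w \<sigma>b p0 (Suc l)) + 1) * chi (Suc l)"
    using assms(1) step.prems unfolding frn_chi_def by (auto dest: bspec [of _ _ "Suc l"])
  moreover have "{n<..Suc l} = insert (Suc l) {n<..l}"
    using step by auto
  ultimately show ?case
    using step by (simp add: algebra_simps)
qed auto

lemma frn_chi_pos:
  assumes "frn_chi \<phi> \<phi>' \<sigma>v \<sigma>a \<sigma>w \<sigma>b p0 L chi" "l \<le> L"
  shows "chi l > 0"
proof -
  have "chi L > 0"
    using assms(1) by (simp add: frn_chi_def)
  thus ?thesis
    using frn_chi_eq_prod [OF assms order_refl]
    by (auto intro!: mult_pos_pos prod_pos add_pos_nonneg mult_nonneg_nonneg gauss_sq_mean_nonneg)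
qed

text \<open>The factor is \<open>B / u k\<close> with \<open>u k\<close> close to
  \<open>g * k\<close>. In the limit constant \<open>B / g\<close> the quantity \<open>A\<close>
  cancels, which is why \<open>R\<close> depends on \<alpha> only.\<close>

lemma frn_alpha_relu_deriv_asymp:
  fixes \<alpha> \<sigma>v \<sigma>a \<sigma>w \<sigma>b p0 :: real
  assumes \<sigma>: "\<sigma>v > 0" "\<sigma>w > 0" "\<sigma>b > 0" and p0: "p0 \<ge> 0" and \<alpha>: "1/2 < \<alpha>" "\<alpha> < 1"
  obtains C where "C \<ge> 0"
    "\<And>k. k \<ge> 1 \<Longrightarrow>
       \<bar>\<sigma>v\<^sup>2 * \<sigma>w\<^sup>2 * gauss_sq_mean (alpha_relu_deriv \<alpha>) (frn_q (alpha_relu \<alpha>) \<sigma>v \<sigma>a \<sigma>w \<sigma>b p0 k)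
         - \<alpha>\<^sup>2 / ((1 - \<alpha>) * (2 * \<alpha> - 1)) / real k\<bar> \<le> C * real k powr (-3/2)"
proof -
  define q where "q = frn_q (alpha_relu \<alpha>) \<sigma>v \<sigma>a \<sigma>w \<sigma>b p0"
  define c where "c = 2 powr \<alpha> * Gamma (\<alpha> + 1 / 2) / (2 * sqrt pi)"
  define A where "A = \<sigma>w\<^sup>2 * \<sigma>v\<^sup>2 * c"
  define B where "B = \<alpha>\<^sup>2 / (2 * \<alpha> - 1) * A"
  define u where "u = (\<lambda>k. q k powr (1 - \<alpha>))"
  define g where "g = (1 - \<alpha>) * A"
  have "c > 0" unfolding c_def using \<alpha> by (auto intro!: divide_pos_pos mult_pos_pos Gamma_real_pos)
  hence A: "A > 0" using \<sigma> by (simp add: A_def)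
  have B: "B \<ge> 0" and g: "g > 0" using A \<alpha> by (simp_all add: B_def g_def)
  have q0: "0 < \<sigma>b\<^sup>2" "\<sigma>b\<^sup>2 \<le> q k" for k
    using frn_q_ge [OF p0] \<sigma> by (simp_all add: q_def)
  have q: "q k > 0" for k
    using q0(1) q0(2) [of k] by linarith
  have rec: "q (Suc k) = q k + A * q k powr \<alpha> + \<sigma>w\<^sup>2 * \<sigma>a\<^sup>2" if "k \<ge> 1" for k
    using frn_q_Suc [OF that, of "alpha_relu \<alpha>"] q [of k] \<alpha>
    by (simp add: q_def gauss_sq_mean_alpha_relu A_def c_def)
  define d where "d = (1 - \<alpha>) * A / (1 + A / (\<sigma>b\<^sup>2) powr (1 - \<alpha>))"
  define K where "K = (1 - \<alpha>) * A\<^sup>2 + (1 - \<alpha>) * (\<sigma>w\<^sup>2 * \<sigma>a\<^sup>2) * (\<sigma>b\<^sup>2) powr (1 - \<alpha> - \<alpha>)"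
  have inc: "d \<le> u (Suc k) - u k" "\<bar>u (Suc k) - u k - g\<bar> \<le> K / u k" if "k \<ge> 1" for k
    using power_recurrence_increment [of \<alpha> A "\<sigma>w\<^sup>2 * \<sigma>a\<^sup>2" "\<sigma>b\<^sup>2" "q k"] \<alpha> A q0(1) q0(2) [of k]
    by (simp_all add: u_def d_def K_def g_def rec [OF that])
  have "u 1 > 0" using q [of 1] by (simp add: u_def)
  moreover have "d > 0" using A \<alpha> q0 by (auto simp: d_def intro!: divide_pos_pos mult_pos_pos add_pos_nonneg)
  moreover have "K \<ge> 0" using A \<alpha> by (simp add: K_def)
  ultimately obtain e C where e: "e > 0" "C \<ge> 0" and lin: "\<And>n. n \<ge> 1 \<Longrightarrow> e * real n \<le> u n"
    and close: "\<And>n. n \<ge> 1 \<Longrightarrow> \<bar>u n - g * real n\<bar> \<le> C * sqrt (real n)"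
    using asymptotically_linear [of u d K g, OF _ _ _ inc] by blast
  show thesis
  proof (rule that [of "B * (C / (e * g))"])
    show "B * (C / (e * g)) \<ge> 0" using B e g by simp
    fix k :: nat
    assume k: "k \<ge> 1"
    have "\<sigma>v\<^sup>2 * \<sigma>w\<^sup>2 * gauss_sq_mean (alpha_relu_deriv \<alpha>) (q k) = B * (1 / u k)"
      using gauss_sq_mean_alpha_relu_deriv [OF q [of k] \<alpha>(1), folded c_def]
      by (simp add: B_def A_def u_def powr_minus [symmetric] divide_inverse mult_ac)
    moreover have "\<alpha>\<^sup>2 / ((1 - \<alpha>) * (2 * \<alpha> - 1)) / real k = B * (1 / (g * real k))"
      using A \<alpha> k by (simp add: B_def g_def)
    ultimately have "\<bar>\<sigma>v\<^sup>2 * \<sigma>w\<^sup>2 * gauss_sq_mean (alpha_relu_deriv \<alpha>) (q k)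
        - \<alpha>\<^sup>2 / ((1 - \<alpha>) * (2 * \<alpha> - 1)) / real k\<bar> = B * \<bar>1 / u k - 1 / (g * real k)\<bar>"
      using B abs_mult [of B "1 / u k - 1 / (g * real k)"] by (simp add: right_diff_distrib)
    also have "\<dots> \<le> B * (C / (e * g) * real k powr (-3/2))"
      by (intro mult_left_mono inverse_asymptotically_linear e(1) g k lin close B)
    finally show "\<bar>\<sigma>v\<^sup>2 * \<sigma>w\<^sup>2 * gauss_sq_mean (alpha_relu_deriv \<alpha>) (frn_q (alpha_relu \<alpha>) \<sigma>v \<sigma>a \<sigma>w \<sigma>b p0 k)
        - \<alpha>\<^sup>2 / ((1 - \<alpha>) * (2 * \<alpha> - 1)) / real k\<bar> \<le> B * (C / (e * g)) * real k powr (-3/2)"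
      by (simp add: q_def mult.assoc)
  qed
qed

theorem theoremB20:
  fixes \<alpha> \<sigma>v \<sigma>a \<sigma>w \<sigma>b p0 :: real
  assumes "\<sigma>v > 0" and "\<sigma>w > 0" and "\<sigma>a > 0" and "\<sigma>b > 0" and "p0 \<ge> 0"
  shows "(\<alpha> = 1 \<longrightarrow>
           (\<forall>L chi. frn_chi (alpha_relu \<alpha>) (alpha_relu_deriv \<alpha>) \<sigma>v \<sigma>a \<sigma>w \<sigma>b p0 L chi \<longrightarrow>
             (\<forall>l m. m \<le> l \<and> l \<le> L \<longrightarrow>
                chi (l - m) = chi l * (1 / 2 * \<sigma>v\<^sup>2 * \<sigma>w\<^sup>2 + 1) ^ m)))
       \<and> (3 / 4 < \<alpha> \<and> \<alpha> < 1 \<longrightarrow>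
           (\<exists>c C. 0 < c \<and> 0 < C \<and>
             (\<forall>L chi. frn_chi (alpha_relu \<alpha>) (alpha_relu_deriv \<alpha>) \<sigma>v \<sigma>a \<sigma>w \<sigma>b p0 L chi \<longrightarrow>
               (\<forall>l m. m < l \<and> l \<le> L \<longrightarrow>
                  (let R = \<alpha>\<^sup>2 / ((1 - \<alpha>) * (2 * \<alpha> - 1));
                       B = chi l * (real l / real (l - m)) powr R
                   in c * B \<le> chi (l - m) \<and> chi (l - m) \<le> C * B)))))"
proof (intro conjI impI allI)
  fix L l m :: nat and chi :: "nat \<Rightarrow> real"
  assume 1: "\<alpha> = 1" and chi: "frn_chi (alpha_relu \<alpha>) (alpha_relu_deriv \<alpha>) \<sigma>v \<sigma>a \<sigma>w \<sigma>b p0 L chi"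
    and l: "m \<le> l \<and> l \<le> L"
  \<comment> \<open>For \<open>\<alpha> = 1\<close> the power of \<open>q\<close> has exponent 0, so
    the mean is the same at every layer: it is the probability that a centred Gaussian is
    positive.\<close>
  have half: "gauss_sq_mean (alpha_relu_deriv \<alpha>) (frn_q (alpha_relu \<alpha>) \<sigma>v \<sigma>a \<sigma>w \<sigma>b p0 k) = 1 / 2" for k
  proof -
    have "0 < \<sigma>b\<^sup>2" using assms by simp
    hence q: "frn_q (alpha_relu \<alpha>) \<sigma>v \<sigma>a \<sigma>w \<sigma>b p0 k > 0"
      using frn_q_ge [OF \<open>p0 \<ge> 0\<close>] less_le_trans by blast
    have "Gamma (3 / 2 :: real) = 1 / 2 * sqrt pi"
    proof -
      have "(1 / 2 :: real) \<notin> \<int>\<^sub>\<le>\<^sub>0"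
        using nonpos_Ints_nonpos [of "1 / 2 :: real"] by auto
      thus ?thesis
        using Gamma_plus1 [of "1 / 2 :: real"] by (simp add: Gamma_one_half_real)
    qed
    thus ?thesis using gauss_sq_mean_alpha_relu_deriv [OF q, of \<alpha>] q 1 by simp
  qed
  show "chi (l - m) = chi l * (1 / 2 * \<sigma>v\<^sup>2 * \<sigma>w\<^sup>2 + 1) ^ m"
    using frn_chi_eq_prod [OF chi, of "l - m" l, unfolded half] l by (simp add: add.commute)
next
  assume \<alpha>: "3 / 4 < \<alpha> \<and> \<alpha> < 1"
  define w where "w = (\<lambda>k. \<sigma>v\<^sup>2 * \<sigma>w\<^sup>2 *
    gauss_sq_mean (alpha_relu_deriv \<alpha>) (frn_q (alpha_relu \<alpha>) \<sigma>v \<sigma>a \<sigma>w \<sigma>b p0 k))"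
  define R where "R = \<alpha>\<^sup>2 / ((1 - \<alpha>) * (2 * \<alpha> - 1))"
  have w: "w k \<ge> 0" for k
    by (simp add: w_def gauss_sq_mean_nonneg)
  have "R \<ge> 0" using \<alpha> by (simp add: R_def)
  moreover obtain C where "C \<ge> 0" "\<And>k. k \<ge> 1 \<Longrightarrow> \<bar>w k - R / real k\<bar> \<le> C * real k powr (-3/2)"
    using frn_alpha_relu_deriv_asymp [of \<sigma>v \<sigma>w \<sigma>b p0 \<alpha> \<sigma>a] assms \<alpha> unfolding w_def R_def by auto
  \<comment> \<open>\<open>S\<close> is fixed before \<open>L\<close>, \<open>chi\<close>,
    \<open>l\<close> and \<open>m\<close> appear, so the constants \<open>exp (- S)\<close> and
    \<open>exp S\<close> are uniform in the depth as well.\<close>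
  ultimately obtain S where S: "\<And>n l. 1 \<le> n \<Longrightarrow> n \<le> l \<Longrightarrow>
      \<bar>(\<Sum>k\<in>{n<..l}. ln (1 + w k)) - R * ln (real l / real n)\<bar> \<le> S"
    using sum_ln_one_plus_asymp [of w R C] w by blast
  have "exp (- S) * (chi l * (real l / real (l - m)) powr R) \<le> chi (l - m)"
    "chi (l - m) \<le> exp S * (chi l * (real l / real (l - m)) powr R)"
    if chi: "frn_chi (alpha_relu \<alpha>) (alpha_relu_deriv \<alpha>) \<sigma>v \<sigma>a \<sigma>w \<sigma>b p0 L chi"
      and l: "m < l" "l \<le> L" for L chi l m
  proof -
    \<comment> \<open>\<open>T\<close> and \<open>P\<close> are the logarithms of the actual and the
      predicted gradient ratio; \<open>m < l\<close> ensures \<open>l - m \<ge> 1\<close>, as the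
      bound by \<open>S\<close> requires.\<close>
    define T where "T = (\<Sum>k\<in>{l - m<..l}. ln (1 + w k))"
    define P where "P = R * ln (real l / real (l - m))"
    have "\<bar>T - P\<bar> \<le> S"
      unfolding T_def P_def using l by (intro S) auto
    hence T: "- S + P \<le> T" "T \<le> S + P"
      by linarith+
    have pos: "chi l > 0" by (rule frn_chi_pos [OF chi l(2)])
    have "(\<Prod>k\<in>{l - m<..l}. 1 + w k) = exp T"
      unfolding T_def exp_sum [OF finite_greaterThanAtMost]
      by (intro prod.cong refl) (simp add: w add_pos_nonneg)
    hence eq: "chi (l - m) = chi l * exp T"
      using frn_chi_eq_prod [OF chi, of "l - m" l] l by (simp add: w_def)
    have powr_eq: "(real l / real (l - m)) powr R = exp P"
      using l by (simp add: P_def powr_def)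
    have "chi l * exp (- S + P) \<le> chi l * exp T" "chi l * exp T \<le> chi l * exp (S + P)"
      using T pos by simp_all
    thus "exp (- S) * (chi l * (real l / real (l - m)) powr R) \<le> chi (l - m)"
      "chi (l - m) \<le> exp S * (chi l * (real l / real (l - m)) powr R)"
      unfolding eq powr_eq exp_add by (simp_all add: mult_ac)
  qed
  thus "\<exists>c C. 0 < c \<and> 0 < C \<and>
             (\<forall>L chi. frn_chi (alpha_relu \<alpha>) (alpha_relu_deriv \<alpha>) \<sigma>v \<sigma>a \<sigma>w \<sigma>b p0 L chi \<longrightarrow>
               (\<forall>l m. m < l \<and> l \<le> L \<longrightarrow>
                  (let R = \<alpha>\<^sup>2 / ((1 - \<alpha>) * (2 * \<alpha> - 1));
                       B = chi l * (real l / real (l - m)) powr R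
                   in c * B \<le> chi (l - m) \<and> chi (l - m) \<le> C * B)))"
    unfolding R_def Let_def by (intro exI [of _ "exp (- S)"] exI [of _ "exp S"]) auto
qed

end
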